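(* Let $I$ be the facet ideal of a simplicial tree $\Delta$ with a good leaf $F_0$ and a good leaf order $F_0,F_1,\ldots,F_q$ on its facets, with $$F_0\cap F_1\supseteq F_0\cap F_2\supseteq\cdots\supseteq F_0\cap F_t\supsetneq F_0\cap F_{t+1}=\cdots=F_0\cap F_q=\emptyset .$$ Identifying facets with the corresponding monomials, let $J=(F_0,\ldots,F_t)$ and $K=(F_{t+1},\ldots,F_q)$. Then $I=J+K$ is a splitting of $I$.
   Context: A simplicial complex $\Delta$ on a finite vertex set is a collection of subsets (faces) containing all singletons and closed under taking subsets; its maximal faces are its facets. $\langle F_1,\ldots,F_r\rangle$ denotes the simplicial complex with facets $F_1,\ldots,F_r$. A subcollection of $\Delta$ is a simplicial complex whose facets are also facets of $\Delta$. $\Delta$ is connected if any two facets are joined by a sequence of facets with consecutive ones intersecting. A facet $F$ of $\Delta$ is a leaf if either $F$ is the only facet of $\Delta$, or there is a facet $G\ne F$ of $\Delta$ (a joint of $F$) with $F\cap H\subseteq G$ for all facets $H\neq F$ of $\Delta$. A simplicial forest is a simplicial complex in which every nonempty subcollection has a leaf; a simplicial tree is a connected simplicial forest. A good leaf of $\Delta$ is a facet that is a leaf of every subcollection of $\Delta$ containing it. For a good leaf $F_0$, a good leaf order on $\Delta$ is an ordering $F_0,F_1,\ldots,F_q$ of all its facets with $F_0\cap F_1\supseteq\cdots\supseteq F_0\cap F_q$ and such that $F_i$ is a leaf of $\langle F_0,\ldots,F_i\rangle$ for every $i\le q$. If $\Delta$ has vertex set $\{x_1,\ldots,x_n\}$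 and $R=k[x_1,\ldots,x_n]$ with $k$ a field, the facet ideal of $\Delta$ is the ideal of $R$ generated by the monomials $\prod_{x\in F}x$, $F$ a facet of $\Delta$. A facet is identified with its monomial. For a monomial ideal $I$, $\mathcal{G}(I)$ is its unique minimal set of monomial generators. A decomposition $I=J+K$ with $J,K$ nonzero monomial ideals is a splitting of $I$ if (1) $\mathcal{G}(I)$ is the disjoint union of $\mathcal{G}(J)$ and $\mathcal{G}(K)$; and (2) there is a function $\mathcal{G}(J\cap K)\to\mathcal{G}(J)\times\mathcal{G}(K)$, $w\mapsto(\phi(w),\psi(w))$, such that (a) $w=\mathrm{lcm}(\phi(w),\psi(w))$ for every $w\in\mathcal{G}(J\cap K)$, and (b) for each nonempty $S\subseteq\mathcal{G}(J\cap K)$, both $\mathrm{lcm}(\phi(S))$ and $\mathrm{lcm}(\psi(S))$ strictly divide $\mathrm{lcm}(S)$ (i.e. divide it and are not equal to it). *)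

theory Defs
  imports HOL.Modules "HOL-Library.Poly_Mapping" "HOL-Library.Set_Algebras"
begin

definition simplicial_complex :: "'v set \<Rightarrow> 'v set set \<Rightarrow> bool" where
  "simplicial_complex V \<Delta> \<longleftrightarrow>
     finite V \<and> \<Delta> \<subseteq> Pow V \<and> (\<forall>v\<in>V. {v} \<in> \<Delta>) \<and> (\<forall>F\<in>\<Delta>. \<forall>G. G \<subseteq> F \<longrightarrow> G \<in> \<Delta>)"

definition facets :: "'v set set \<Rightarrow> 'v set set" where
  "facets \<Delta> = {F \<in> \<Delta>. \<forall>G\<in>\<Delta>. F \<subseteq> G \<longrightarrow> G = F}"

text \<open>The complex \<open>\<langle>F\<^sub>1, \<dots>, F\<^sub>r\<rangle>\<close>. Its facets are the maximal elements of the given family,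
  hence the whole family whenever this is an antichain, e.g. a set of facets of some complex.\<close>

definition complex_of :: "'v set set \<Rightarrow> 'v set set" where
  "complex_of \<F> = {G. \<exists>F\<in>\<F>. G \<subseteq> F}"

definition subcollection :: "'v set set \<Rightarrow> 'v set set \<Rightarrow> bool" where
  "subcollection \<Gamma> \<Delta> \<longleftrightarrow> simplicial_complex (\<Union>\<Gamma>) \<Gamma> \<and> facets \<Gamma> \<subseteq> facets \<Delta>"

definition connected_complex :: "'v set set \<Rightarrow> bool" where
  "connected_complex \<Delta> \<longleftrightarrow>
     (\<forall>F\<in>facets \<Delta>. \<forall>G\<in>facets \<Delta>.
        (F, G) \<in> {(A, B). A \<in> facets \<Delta> \<and> B \<in> facets \<Delta> \<and> A \<inter> B \<noteq> {}}\<^sup>*)"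

definition leaf :: "'v set \<Rightarrow> 'v set set \<Rightarrow> bool" where
  "leaf F \<Delta> \<longleftrightarrow>
     F \<in> facets \<Delta> \<and>
     (facets \<Delta> = {F} \<or>
      (\<exists>G\<in>facets \<Delta>. G \<noteq> F \<and> (\<forall>H\<in>facets \<Delta>. H \<noteq> F \<longrightarrow> F \<inter> H \<subseteq> G)))"

definition simplicial_forest :: "'v set \<Rightarrow> 'v set set \<Rightarrow> bool" where
  "simplicial_forest V \<Delta> \<longleftrightarrow>
     simplicial_complex V \<Delta> \<and> (\<forall>\<Gamma>. subcollection \<Gamma> \<Delta> \<and> \<Gamma> \<noteq> {} \<longrightarrow> (\<exists>F. leaf F \<Gamma>))"

definition simplicial_tree :: "'v set \<Rightarrow> 'v set set \<Rightarrow> bool" where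
  "simplicial_tree V \<Delta> \<longleftrightarrow> simplicial_forest V \<Delta> \<and> connected_complex \<Delta>"

definition good_leaf :: "'v set \<Rightarrow> 'v set set \<Rightarrow> bool" where
  "good_leaf F \<Delta> \<longleftrightarrow>
     F \<in> facets \<Delta> \<and> (\<forall>\<Gamma>. subcollection \<Gamma> \<Delta> \<and> F \<in> facets \<Gamma> \<longrightarrow> leaf F \<Gamma>)"

text \<open>\<open>good_leaf_order \<Delta> F q\<close>: the sequence \<open>F 0, \<dots>, F q\<close> is a good leaf order on \<open>\<Delta>\<close>;
  the values of \<open>F\<close> beyond \<open>q\<close> are irrelevant.\<close>

definition good_leaf_order :: "'v set set \<Rightarrow> (nat \<Rightarrow> 'v set) \<Rightarrow> nat \<Rightarrow> bool" where
  "good_leaf_order \<Delta> F q \<longleftrightarrow>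
     good_leaf (F 0) \<Delta> \<and>
     bij_betw F {0..q} (facets \<Delta>) \<and>
     (\<forall>i. 1 \<le> i \<and> i < q \<longrightarrow> F 0 \<inter> F (Suc i) \<subseteq> F 0 \<inter> F i) \<and>
     (\<forall>i\<le>q. leaf (F i) (complex_of (F ` {0..i})))"

text \<open>\<open>('v, 'k) polyring\<close> is the polynomial ring over \<open>'k\<close> in the variables \<open>'v\<close>: finitely
  supported maps from exponent vectors to coefficients, with convolution as multiplication.\<close>

type_synonym ('v, 'k) polyring = "('v \<Rightarrow>\<^sub>0 nat) \<Rightarrow>\<^sub>0 'k"

definition var :: "'v \<Rightarrow> ('v, 'k::comm_ring_1) polyring" where
  "var x = Poly_Mapping.single (Poly_Mapping.single x 1) 1"

definition monomials :: "('v, 'k::comm_ring_1) polyring set" where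
  "monomials = range (\<lambda>m. Poly_Mapping.single m 1)"

text \<open>A commutative ring is a module over itself, whose submodules are the ideals.\<close>

lemma module_times: "module ((*) :: 'a::comm_ring_1 \<Rightarrow> 'a \<Rightarrow> 'a)"
  by standard (simp_all add: algebra_simps)

definition ideal_gen :: "'a::comm_ring_1 set \<Rightarrow> 'a set" where
  "ideal_gen B = module.span (*) B"

definition monomial_ideal :: "('v, 'k::comm_ring_1) polyring set \<Rightarrow> bool" where
  "monomial_ideal I \<longleftrightarrow> (\<exists>M \<subseteq> monomials. I = ideal_gen M)"

text \<open>For a monomial ideal such a \<open>G\<close> exists and is unique; for other ideals the value is unspecified.\<close>

definition min_gens :: "('v, 'k::comm_ring_1) polyring set \<Rightarrow> ('v, 'k) polyring set" where
  "min_gens I = (THE G. G \<subseteq> monomials \<and> ideal_gen G = I \<and> (\<forall>H. H \<subset> G \<longrightarrow> ideal_gen H \<noteq> I))"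

text \<open>The least common multiple of a finite set of monomials. In the polynomial ring it is
  determined up to a unit; requiring it to be a monomial makes it unique.\<close>

definition monomial_lcm :: "('v, 'k::comm_ring_1) polyring set \<Rightarrow> ('v, 'k) polyring" where
  "monomial_lcm A =
     (THE w. w \<in> monomials \<and> (\<forall>a\<in>A. a dvd w) \<and> (\<forall>c. (\<forall>a\<in>A. a dvd c) \<longrightarrow> w dvd c))"

definition splitting ::
  "('v, 'k::comm_ring_1) polyring set \<Rightarrow> ('v, 'k) polyring set \<Rightarrow> ('v, 'k) polyring set \<Rightarrow> bool"
where
  "splitting I J K \<longleftrightarrow>
     monomial_ideal J \<and> monomial_ideal K \<and> J \<noteq> {0} \<and> K \<noteq> {0} \<and> I = J + K \<and>
     min_gens I = min_gens J \<union> min_gens K \<and> min_gens J \<inter> min_gens K = {} \<and>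
     (\<exists>\<phi> \<psi>.
        (\<forall>w \<in> min_gens (J \<inter> K).
           \<phi> w \<in> min_gens J \<and> \<psi> w \<in> min_gens K \<and> w = monomial_lcm {\<phi> w, \<psi> w}) \<and>
        (\<forall>S. S \<subseteq> min_gens (J \<inter> K) \<and> S \<noteq> {} \<longrightarrow>
           monomial_lcm (\<phi> ` S) dvd monomial_lcm S \<and> monomial_lcm (\<phi> ` S) \<noteq> monomial_lcm S \<and>
           monomial_lcm (\<psi> ` S) dvd monomial_lcm S \<and> monomial_lcm (\<psi> ` S) \<noteq> monomial_lcm S))"

definition facet_monomial :: "'v set \<Rightarrow> ('v, 'k::comm_ring_1) polyring" where
  "facet_monomial F = (\<Prod>x\<in>F. var x)"

definition facet_ideal :: "'v set set \<Rightarrow> ('v, 'k::comm_ring_1) polyring set" where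
  "facet_ideal \<Delta> = ideal_gen (facet_monomial ` facets \<Delta>)"

end

(* The facets form an antichain, so they are the minimal generators of I, J and K, and
   G(J \<inter> K) consists of the minimal unions of a facet in J with one in K.  Any choice of a
   representation w = F_i \<union> F_j with i \<le> t < j gives a splitting function.  The union of the chosen F_j
   misses F_0, whereas every F_i with i \<le> t meets F_0.  The union of the chosen F_i contains no F_j with j > t:
   as F_j is a leaf of the complex of F_0, ..., F_j, its intersections with all earlier facets
   lie in a single joint, and F_j is not contained in that joint. *)

theory Submission
  imports Defs
begin

section \<open>Exponent vectors and membership in monomial ideals\<close>

abbreviation monom :: "('v \<Rightarrow>\<^sub>0 nat) \<Rightarrow> ('v, 'k::comm_ring_1) polyring" where
  "monom m \<equiv> Poly_Mapping.single m 1"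

text \<open>Divisibility of monomials, read on exponents. The existential form yields the cofactor
  \<open>k\<close>; \<open>exp_le_iff\<close> supplies the pointwise form.\<close>

definition exp_le :: "('v \<Rightarrow>\<^sub>0 nat) \<Rightarrow> ('v \<Rightarrow>\<^sub>0 nat) \<Rightarrow> bool" where
  "exp_le m n \<longleftrightarrow> (\<exists>k. n = m + k)"

lemma exp_le_iff: "exp_le m n \<longleftrightarrow> (\<forall>x. Poly_Mapping.lookup m x \<le> Poly_Mapping.lookup n x)"
proof
  assume "\<forall>x. Poly_Mapping.lookup m x \<le> Poly_Mapping.lookup n x"
  then have "n = m + (n - m)"
    by (intro poly_mapping_eqI) (simp add: lookup_add lookup_minus)
  then show "exp_le m n"
    unfolding exp_le_def by blast
qed (auto simp: exp_le_def lookup_add)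

lemma exp_le_refl: "exp_le m m"
  by (simp add: exp_le_iff)

lemma exp_le_trans: "exp_le a b \<Longrightarrow> exp_le b c \<Longrightarrow> exp_le a c"
  by (meson exp_le_iff order_trans)

lemma exp_le_antisym: "exp_le a b \<Longrightarrow> exp_le b a \<Longrightarrow> a = b"
  by (meson exp_le_iff antisym poly_mapping_eqI)

lemma inj_monom: "inj (monom :: ('v \<Rightarrow>\<^sub>0 nat) \<Rightarrow> ('v, 'k::comm_ring_1) polyring)"
proof (rule injI)
  fix m n :: "'v \<Rightarrow>\<^sub>0 nat"
  assume "monom m = (monom n :: ('v, 'k) polyring)"
  then have "Poly_Mapping.keys (monom m :: ('v, 'k) polyring) = Poly_Mapping.keys (monom n :: ('v, 'k) polyring)"
    by simp
  then show "m = n" by simp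
qed

lemma sum_single_lookup: "(\<Sum>n\<in>Poly_Mapping.keys p. Poly_Mapping.single n (Poly_Mapping.lookup p n)) = p"
proof (rule poly_mapping_eqI)
  fix k
  have "Poly_Mapping.lookup (\<Sum>n\<in>Poly_Mapping.keys p. Poly_Mapping.single n (Poly_Mapping.lookup p n)) k =
      (\<Sum>n\<in>Poly_Mapping.keys p. if k = n then Poly_Mapping.lookup p n else 0)"
    unfolding lookup_sum by (intro sum.cong) (auto simp: lookup_single when_def)
  also have "\<dots> = Poly_Mapping.lookup p k"
    by (simp add: in_keys_iff)
  finally show "Poly_Mapping.lookup (\<Sum>n\<in>Poly_Mapping.keys p. Poly_Mapping.single n (Poly_Mapping.lookup p n)) k = Poly_Mapping.lookup p k" .
qed

text \<open>The polynomials passing the test form an ideal containing the generators, which gives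
  one direction. Conversely, each term of such a polynomial is a multiple of a generator, and the
  polynomial is the sum of its terms.\<close>

lemma ideal_gen_monom_iff:
  fixes p :: "('v, 'k::comm_ring_1) polyring"
  shows "p \<in> ideal_gen (monom ` A) \<longleftrightarrow> (\<forall>n\<in>Poly_Mapping.keys p. \<exists>m\<in>A. exp_le m n)"
proof
  let ?T = "{p :: ('v, 'k) polyring. \<forall>n\<in>Poly_Mapping.keys p. \<exists>m\<in>A. exp_le m n}"
  have "module.subspace (*) ?T"
    unfolding module.subspace_def[OF module_times]
  proof (intro conjI ballI allI)
    fix p r :: "('v, 'k) polyring"
    assume p: "p \<in> ?T"
    show "r * p \<in> ?T"
    proof (intro CollectI ballI)
      fix n assume "n \<in> Poly_Mapping.keys (r * p)"
      then obtain a b where n: "n = a + b" and b: "b \<in> Poly_Mapping.keys p"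
        using keys_mult[of r p] by blast
      then obtain m where "m \<in> A" "exp_le m b" using p by blast
      then show "\<exists>m\<in>A. exp_le m n"
        unfolding n exp_le_iff by (metis lookup_add trans_le_add2)
    qed
  next
    fix p r :: "('v, 'k) polyring"
    assume "p \<in> ?T" "r \<in> ?T"
    then show "p + r \<in> ?T" using Poly_Mapping.keys_add[of p r] by blast
  qed simp
  moreover have "monom ` A \<subseteq> ?T" using exp_le_refl by fastforce
  ultimately have "ideal_gen (monom ` A) \<subseteq> ?T"
    unfolding ideal_gen_def by (intro module.span_minimal[OF module_times])
  moreover assume "p \<in> ideal_gen (monom ` A)"
  ultimately have "p \<in> ?T" by (rule subsetD)
  then show "\<forall>n\<in>Poly_Mapping.keys p. \<exists>m\<in>A. exp_le m n" by simp
next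
  assume p: "\<forall>n\<in>Poly_Mapping.keys p. \<exists>m\<in>A. exp_le m n"
  \<comment> \<open>The coefficient can be arbitrary because the multiplier
    \<open>single k c\<close> carries it.\<close>
  have "Poly_Mapping.single n c \<in> ideal_gen (monom ` A)"
    if n: "n \<in> Poly_Mapping.keys p" for n and c :: 'k
  proof -
    obtain m where "m \<in> A" "exp_le m n" using p n by blast
    then obtain k where n: "n = m + k" unfolding exp_le_def by blast
    have "(Poly_Mapping.single k c :: ('v, 'k) polyring) * monom m \<in> ideal_gen (monom ` A)"
      unfolding ideal_gen_def
      by (intro module.span_scale[OF module_times] module.span_base[OF module_times] imageI \<open>m \<in> A\<close>)
    then show ?thesis by (simp add: n mult_single add.commute)
  qed
  then have "(\<Sum>n\<in>Poly_Mapping.keys p. Poly_Mapping.single n (Poly_Mapping.lookup p n)) \<in> ideal_gen (monom ` A)"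
    unfolding ideal_gen_def by (intro module.span_sum[OF module_times])
  then show "p \<in> ideal_gen (monom ` A)"
    by (simp add: sum_single_lookup)
qed

text \<open>Divisibility is membership in a principal ideal, so the term test applies. An arbitrary
  polynomial \<open>c\<close> is allowed because \<open>monomial_lcm\<close> compares with all
  common multiples, not only with monomials.\<close>

lemma monom_dvd_iff:
  fixes c :: "('v, 'k::comm_ring_1) polyring"
  shows "monom m dvd c \<longleftrightarrow> (\<forall>n\<in>Poly_Mapping.keys c. exp_le m n)"
proof -
  have "monom m dvd c \<longleftrightarrow> c \<in> ideal_gen (monom ` {m})"
    by (auto simp: ideal_gen_def module.span_singleton[OF module_times] dvd_def image_iff mult.commute)
  then show ?thesis using ideal_gen_monom_iff[of c "{m}"] by simp
qed

text \<open>Since \<open>min_gens\<close> is a definite description, irredundancy of the antichain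
  and uniqueness are both required.\<close>

lemma min_gens_antichain:
  assumes anti: "\<And>a b. a \<in> A \<Longrightarrow> b \<in> A \<Longrightarrow> exp_le a b \<Longrightarrow> a = b"
  shows "min_gens (ideal_gen (monom ` A)) = (monom ` A :: ('v, 'k::comm_ring_1) polyring set)"
  unfolding min_gens_def
proof (rule the_equality)
  let ?X = "monom :: ('v \<Rightarrow>\<^sub>0 nat) \<Rightarrow> ('v, 'k) polyring"
  have below: "\<exists>b\<in>B. exp_le b a" if "?X a \<in> ideal_gen (?X ` B)" for a B
    using that by (simp add: ideal_gen_monom_iff)
  have gen: "?X a \<in> ideal_gen (?X ` B)" if "a \<in> B" for a B
    using that exp_le_refl by (auto simp: ideal_gen_monom_iff)
  show "?X ` A \<subseteq> monomials \<and> ideal_gen (?X ` A) = ideal_gen (?X ` A) \<and>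
    (\<forall>H. H \<subset> ?X ` A \<longrightarrow> ideal_gen H \<noteq> ideal_gen (?X ` A))"
  proof (intro conjI allI impI notI)
    fix H assume H: "H \<subset> ?X ` A" and eq: "ideal_gen H = ideal_gen (?X ` A)"
    obtain B where B: "B \<subseteq> A" "H = ?X ` B"
      using H by (meson psubset_imp_subset subset_imageE)
    then obtain a where a: "a \<in> A" "a \<notin> B" using H by blast
    then have "?X a \<in> ideal_gen (?X ` B)" using gen[of a A] eq B(2) by simp
    then obtain b where "b \<in> B" "exp_le b a" using below by blast
    then show False using anti a B(1) by blast
  qed (auto simp: monomials_def)
  fix G assume G: "G \<subseteq> monomials \<and> ideal_gen G = ideal_gen (?X ` A) \<and>
    (\<forall>H. H \<subset> G \<longrightarrow> ideal_gen H \<noteq> ideal_gen (?X ` A))"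
  then obtain B where B: "G = ?X ` B"
    unfolding monomials_def by (meson subset_imageE)
  \<comment> \<open>Each \<open>a\<close> lies above some \<open>b\<close> in \<open>B\<close>,
    which lies above some \<open>a'\<close> in \<open>A\<close>. The antichain condition collapses
    this sandwich, so \<open>b = a\<close>.\<close>
  have "A \<subseteq> B"
  proof
    fix a assume a: "a \<in> A"
    then have "?X a \<in> ideal_gen (?X ` B)" using gen B G by simp
    then obtain b where b: "b \<in> B" "exp_le b a" using below by blast
    then have "?X b \<in> ideal_gen (?X ` A)" using gen B G by blast
    then obtain a' where a': "a' \<in> A" "exp_le a' b" using below by blast
    have "a' = a" by (rule anti[OF a'(1) a exp_le_trans[OF a'(2) b(2)]])
    then have "b = a" using a'(2) b(2) exp_le_antisym by blast
    then show "a \<in> B" using b(1) by simp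
  qed
  then have "?X ` A \<subseteq> G" unfolding B by (rule image_mono)
  \<comment> \<open>A strict inclusion would contradict the minimality of \<open>G\<close>, as both
    sets generate the same ideal.\<close>
  then show "G = ?X ` A" using G by (metis psubsetI)
qed

section \<open>Squarefree monomials as vertex sets\<close>

definition indicator_exp :: "'v::finite set \<Rightarrow> ('v \<Rightarrow>\<^sub>0 nat)" where
  "indicator_exp F = (\<Sum>x\<in>F. Poly_Mapping.single x 1)"

lemma lookup_indicator_exp: "Poly_Mapping.lookup (indicator_exp F) x = (if x \<in> F then 1 else 0)"
  by (simp add: indicator_exp_def lookup_sum lookup_single when_def)

text \<open>The nonzero exponents on the left are all 1, so only the support of \<open>m\<close>
  matters. This turns ideal membership into set inclusion.\<close>

lemma exp_le_indicator_iff: "exp_le (indicator_exp F) m \<longleftrightarrow> F \<subseteq> Poly_Mapping.keys m"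
  by (auto simp: exp_le_iff lookup_indicator_exp subset_eq in_keys_iff Suc_le_eq)

lemma exp_le_indicator_indicator: "exp_le (indicator_exp F) (indicator_exp G) \<longleftrightarrow> F \<subseteq> G"
  by (auto simp: exp_le_indicator_iff lookup_indicator_exp subset_eq in_keys_iff)

lemma facet_monomial_eq:
  fixes F :: "'v::finite set"
  shows "(facet_monomial F :: ('v, 'k::comm_ring_1) polyring) = monom (indicator_exp F)"
proof -
  have "finite F" by simp
  then show ?thesis
    unfolding facet_monomial_def indicator_exp_def var_def
    by (induction F rule: finite_induct) (simp_all add: mult_single)
qed

lemma facet_monomial_image: "facet_monomial ` A = monom ` indicator_exp ` A"
  by (simp add: facet_monomial_eq image_image)

lemma ideal_gen_facet_monomial_iff:
  fixes p :: "('v::finite, 'k::comm_ring_1) polyring"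
  shows "p \<in> ideal_gen (facet_monomial ` A) \<longleftrightarrow>
    (\<forall>n\<in>Poly_Mapping.keys p. \<exists>F\<in>A. F \<subseteq> Poly_Mapping.keys n)"
  by (simp add: facet_monomial_image ideal_gen_monom_iff exp_le_indicator_iff)

lemma facet_monomial_eq_iff [simp]:
  "(facet_monomial F :: ('v::finite, 'k::comm_ring_1) polyring) = facet_monomial G \<longleftrightarrow> F = G"
  by (metis facet_monomial_eq injD inj_monom exp_le_indicator_indicator subset_antisym subset_refl)

lemma facet_monomial_dvd_iff:
  "(facet_monomial F :: ('v::finite, 'k::comm_ring_1) polyring) dvd facet_monomial G \<longleftrightarrow> F \<subseteq> G"
  by (simp add: facet_monomial_eq monom_dvd_iff exp_le_indicator_indicator)

text \<open>A monomial is divisible by all the given ones exactly when its support contains each of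
  the sets, hence their union.\<close>

lemma monomial_lcm_facet_monomials:
  "monomial_lcm (facet_monomial ` A) =
    (facet_monomial (\<Union>A) :: ('v::finite, 'k::comm_ring_1) polyring)"
  unfolding monomial_lcm_def
proof (rule the_equality)
  let ?X = "facet_monomial :: 'v set \<Rightarrow> ('v, 'k) polyring"
  have least: "?X (\<Union>A) dvd c" if "\<forall>a\<in>?X ` A. a dvd c" for c
    using that by (auto simp: facet_monomial_eq monom_dvd_iff exp_le_indicator_iff)
  have ub: "\<forall>a\<in>?X ` A. a dvd ?X (\<Union>A)"
    by (auto simp: facet_monomial_dvd_iff)
  show "?X (\<Union>A) \<in> monomials \<and> (\<forall>a\<in>?X ` A. a dvd ?X (\<Union>A)) \<and>
    (\<forall>c. (\<forall>a\<in>?X ` A. a dvd c) \<longrightarrow> ?X (\<Union>A) dvd c)"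
    using least ub by (auto simp: monomials_def facet_monomial_eq)
  fix w assume w: "w \<in> monomials \<and> (\<forall>a\<in>?X ` A. a dvd w) \<and> (\<forall>c. (\<forall>a\<in>?X ` A. a dvd c) \<longrightarrow> w dvd c)"
  then obtain m where m: "w = monom m" by (auto simp: monomials_def)
  \<comment> \<open>Two least common multiples divide each other; as both are monomials, their
    exponents agree and no unit factor remains.\<close>
  have "?X (\<Union>A) dvd w" "w dvd ?X (\<Union>A)" using w least ub by blast+
  then show "w = ?X (\<Union>A)"
    by (simp add: m facet_monomial_eq monom_dvd_iff) (metis exp_le_antisym)
qed

text \<open>An exponent vector passes both membership tests iff its support contains some
  \<open>a\<close> and some \<open>b\<close>, that is, their union. These unions may contain one
  another, so they generate but may be redundant.\<close>

lemma facet_ideal_inter: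
  "ideal_gen (facet_monomial ` A) \<inter> ideal_gen (facet_monomial ` B) =
    (ideal_gen (facet_monomial ` (\<lambda>(a, b). a \<union> b) ` (A \<times> B))
      :: ('v::finite, 'k::comm_ring_1) polyring set)"
proof -
  have union: "(\<exists>F\<in>(\<lambda>(a, b). a \<union> b) ` (A \<times> B). F \<subseteq> N) \<longleftrightarrow> (\<exists>a\<in>A. a \<subseteq> N) \<and> (\<exists>b\<in>B. b \<subseteq> N)" for N
    by auto
  show ?thesis
    unfolding set_eq_iff Int_iff ideal_gen_facet_monomial_iff union by blast
qed

lemma min_gens_facet_monomials:
  assumes "\<And>a b. a \<in> A \<Longrightarrow> b \<in> A \<Longrightarrow> a \<subseteq> b \<Longrightarrow> a = b"
  shows "min_gens (ideal_gen (facet_monomial ` A)) =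
    (facet_monomial ` A :: ('v::finite, 'k::comm_ring_1) polyring set)"
  unfolding facet_monomial_image
  by (rule min_gens_antichain) (use assms exp_le_indicator_indicator in blast)

text \<open>Meant for the unions generating an intersection. By finiteness every member lies above a
  minimal one, so the minimal members, which form an antichain, generate the same ideal.\<close>

lemma min_gens_facet_monomials_minimal:
  fixes U :: "'v::finite set set"
  shows "min_gens (ideal_gen (facet_monomial ` U)) =
    (facet_monomial ` {u \<in> U. \<forall>v\<in>U. v \<subseteq> u \<longrightarrow> v = u} :: ('v, 'k::comm_ring_1) polyring set)"
proof -
  let ?M = "{u \<in> U. \<forall>v\<in>U. v \<subseteq> u \<longrightarrow> v = u}"
  have min: "\<exists>m\<in>?M. m \<subseteq> u" if "u \<in> U" for u
    using finite_has_minimal2[OF finite that] by blast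
  have "(\<exists>u\<in>U. u \<subseteq> N) \<longleftrightarrow> (\<exists>u\<in>?M. u \<subseteq> N)" for N
  proof
    assume "\<exists>u\<in>U. u \<subseteq> N"
    then obtain u where "u \<in> U" "u \<subseteq> N" by blast
    with min[of u] show "\<exists>u\<in>?M. u \<subseteq> N" by (meson subset_trans)
  qed blast
  then have "(ideal_gen (facet_monomial ` U) :: ('v, 'k) polyring set) = ideal_gen (facet_monomial ` ?M)"
    unfolding set_eq_iff ideal_gen_facet_monomial_iff by simp
  moreover have "min_gens (ideal_gen (facet_monomial ` ?M)) = (facet_monomial ` ?M :: ('v, 'k) polyring set)"
    by (rule min_gens_facet_monomials) auto
  ultimately show ?thesis by simp
qed

text \<open>The theorem stripped of simplicial language. The set \<open>C\<close> separates
  \<open>A\<close> from \<open>B\<close>, giving disjoint generators and strictness for \<psi>;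
  \<open>uncovered\<close> gives strictness for \<phi>.\<close>

lemma splitting_facet_monomials:
  fixes A B :: "'v::finite set set"
  assumes anti: "\<And>a b. a \<in> A \<union> B \<Longrightarrow> b \<in> A \<union> B \<Longrightarrow> a \<subseteq> b \<Longrightarrow> a = b"
    and ne: "A \<noteq> {}" "B \<noteq> {}"
    and meet: "\<And>a. a \<in> A \<Longrightarrow> a \<inter> C \<noteq> {}"
    and miss: "\<And>b. b \<in> B \<Longrightarrow> b \<inter> C = {}"
    and uncovered: "\<And>b. b \<in> B \<Longrightarrow> \<not> b \<subseteq> \<Union>A"
  shows "splitting (ideal_gen (facet_monomial ` (A \<union> B)))
    (ideal_gen (facet_monomial ` A)) (ideal_gen (facet_monomial ` B) :: ('v, 'k::comm_ring_1) polyring set)"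
proof -
  let ?X = "facet_monomial :: 'v set \<Rightarrow> ('v, 'k) polyring"
  let ?J = "ideal_gen (?X ` A)" and ?K = "ideal_gen (?X ` B)"
  let ?U = "(\<lambda>(a, b). a \<union> b) ` (A \<times> B)"
  define M where "M = {u \<in> ?U. \<forall>v\<in>?U. v \<subseteq> u \<longrightarrow> v = u}"
  have mono: "monomial_ideal (ideal_gen (?X ` E))" for E
    unfolding monomial_ideal_def
    by (rule exI[of _ "?X ` E"]) (auto simp: monomials_def facet_monomial_eq)
  have nonzero: "ideal_gen (?X ` E) \<noteq> {0}" if E: "E \<noteq> {}" for E
  proof -
    obtain e where "e \<in> E" using E by blast
    then have "?X e \<in> ideal_gen (?X ` E)"
      unfolding ideal_gen_def by (intro module.span_base[OF module_times]) simp
    moreover have "?X e \<noteq> 0" by (metis facet_monomial_eq keys_single keys_zero insert_not_empty one_neq_zero)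
    ultimately show ?thesis by blast
  qed
  have sum: "ideal_gen (?X ` (A \<union> B)) = ?J + ?K"
    by (auto simp: ideal_gen_def image_Un module.span_Un[OF module_times] set_plus_def)
  have mgJ: "min_gens ?J = ?X ` A" and mgK: "min_gens ?K = ?X ` B"
    and mgI: "min_gens (ideal_gen (?X ` (A \<union> B))) = ?X ` (A \<union> B)"
    by (rule min_gens_facet_monomials, use anti in blast)+
  have mgM: "min_gens (?J \<inter> ?K) = ?X ` M"
    unfolding facet_ideal_inter min_gens_facet_monomials_minimal M_def ..
  have disj: "?X ` A \<inter> ?X ` B = {}"
    using meet miss by fastforce
  have "\<forall>u\<in>M. \<exists>a b. a \<in> A \<and> b \<in> B \<and> u = a \<union> b"
    by (auto simp: M_def)
  then obtain f g where fg: "\<And>u. u \<in> M \<Longrightarrow> f u \<in> A \<and> g u \<in> B \<and> u = f u \<union> g u"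
    by metis
  \<comment> \<open>\<open>inv ?X\<close> recovers the vertex set from its monomial; values off the
    range of \<open>?X\<close> are irrelevant.\<close>
  define \<phi> where "\<phi> w = ?X (f (inv ?X w))" for w
  define \<psi> where "\<psi> w = ?X (g (inv ?X w))" for w
  have [simp]: "\<phi> (?X u) = ?X (f u)" "\<psi> (?X u) = ?X (g u)" for u
    by (simp_all add: \<phi>_def \<psi>_def inv_f_f inj_def)
  have lcm: "\<phi> w \<in> ?X ` A \<and> \<psi> w \<in> ?X ` B \<and> w = monomial_lcm {\<phi> w, \<psi> w}" if "w \<in> ?X ` M" for w
  proof -
    obtain u where u: "u \<in> M" "w = ?X u" using \<open>w \<in> ?X ` M\<close> by blast
    have "monomial_lcm {?X (f u), ?X (g u)} = ?X u"
      using monomial_lcm_facet_monomials[of "{f u, g u}"] fg[OF u(1)] by simp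
    then show ?thesis using fg[OF u(1)] by (simp add: u)
  qed
  have strict: "monomial_lcm (\<phi> ` S) dvd monomial_lcm S \<and> monomial_lcm (\<phi> ` S) \<noteq> monomial_lcm S \<and>
      monomial_lcm (\<psi> ` S) dvd monomial_lcm S \<and> monomial_lcm (\<psi> ` S) \<noteq> monomial_lcm S"
    if S: "S \<subseteq> ?X ` M" "S \<noteq> {}" for S
  proof -
    obtain T where T: "T \<subseteq> M" "S = ?X ` T" using S(1) by (meson subset_imageE)
    then obtain u where u: "u \<in> T" using S(2) by blast
    have imgs: "\<phi> ` S = ?X ` f ` T" "\<psi> ` S = ?X ` g ` T"
      by (simp_all add: T(2) image_image)
    have fA: "f v \<in> A" and gB: "g v \<in> B" and f_sub: "f v \<subseteq> v" and g_sub: "g v \<subseteq> v"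
      if "v \<in> T" for v
      using fg[OF subsetD[OF T(1) that]] by auto
    \<comment> \<open>Strictness for \<phi>: the part \<open>g u\<close> lies in the full union, but
      all of \<open>A\<close> together fails to cover it.\<close>
    have "\<Union>(f ` T) \<subseteq> \<Union>A" using fA by auto
    with uncovered[OF gB[OF u]] have "\<not> g u \<subseteq> \<Union>(f ` T)" by (meson subset_trans)
    moreover have "g u \<subseteq> \<Union>T" using g_sub[OF u] u by auto
    ultimately have "\<Union>(f ` T) \<noteq> \<Union>T" by auto
    \<comment> \<open>Strictness for \<psi>: no chosen member of \<open>B\<close> touches
      \<open>C\<close>, whereas \<open>f u\<close>, a part of the full union, does.\<close>
    moreover have "\<Union>(g ` T) \<inter> C = {}" using miss[OF gB] by auto
    moreover have "\<Union>T \<inter> C \<noteq> {}" using meet[OF fA[OF u]] f_sub[OF u] u by blast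
    ultimately have "\<Union>(f ` T) \<noteq> \<Union>T" "\<Union>(g ` T) \<noteq> \<Union>T" by metis+
    moreover have "\<Union>(f ` T) \<subseteq> \<Union>T" "\<Union>(g ` T) \<subseteq> \<Union>T"
      using f_sub g_sub by (meson UN_least Union_upper subset_trans)+
    ultimately show ?thesis
      unfolding imgs unfolding T(2) monomial_lcm_facet_monomials
      by (simp add: facet_monomial_dvd_iff)
  qed
  show ?thesis
    unfolding splitting_def mgJ mgK mgI mgM
  proof (intro conjI; (rule exI[of _ \<phi>], rule exI[of _ \<psi>], rule conjI)?)
    show "\<forall>w\<in>?X ` M. \<phi> w \<in> ?X ` A \<and> \<psi> w \<in> ?X ` B \<and> w = monomial_lcm {\<phi> w, \<psi> w}"
      using lcm by blast
    show "\<forall>S. S \<subseteq> ?X ` M \<and> S \<noteq> {} \<longrightarrow>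
        monomial_lcm (\<phi> ` S) dvd monomial_lcm S \<and> monomial_lcm (\<phi> ` S) \<noteq> monomial_lcm S \<and>
        monomial_lcm (\<psi> ` S) dvd monomial_lcm S \<and> monomial_lcm (\<psi> ` S) \<noteq> monomial_lcm S"
      using strict by simp
  qed (use mono nonzero ne sum disj in \<open>simp_all add: image_Un\<close>)
qed

section \<open>Facets and leaves\<close>

lemma facets_antichain: "F \<in> facets \<Delta> \<Longrightarrow> G \<in> facets \<Delta> \<Longrightarrow> F \<subseteq> G \<Longrightarrow> F = G"
  by (auto simp: facets_def)

lemma facets_complex_of:
  assumes "\<And>F G. F \<in> \<F> \<Longrightarrow> G \<in> \<F> \<Longrightarrow> F \<subseteq> G \<Longrightarrow> F = G"
  shows "facets (complex_of \<F>) = \<F>"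
  using assms unfolding facets_def complex_of_def by blast

text \<open>A joint contains the intersection of \<open>F\<close> with every other facet, so a cover
  by other facets would place \<open>F\<close> inside its joint. Nonemptiness of \<H> provides a
  second facet, so that a joint exists.\<close>

lemma leaf_not_subset_Union:
  assumes "leaf F \<Delta>" and "\<H> \<subseteq> facets \<Delta> - {F}" and "\<H> \<noteq> {}"
  shows "\<not> F \<subseteq> \<Union>\<H>"
proof
  assume "F \<subseteq> \<Union>\<H>"
  have "facets \<Delta> \<noteq> {F}" using assms(2,3) by auto
  then obtain G where "G \<in> facets \<Delta>" "G \<noteq> F" and joint: "\<forall>H\<in>facets \<Delta>. H \<noteq> F \<longrightarrow> F \<inter> H \<subseteq> G"
    using assms(1) unfolding leaf_def by auto
  have "F \<subseteq> G"
  proof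
    fix x assume "x \<in> F"
    then obtain H where "H \<in> \<H>" "x \<in> H" using \<open>F \<subseteq> \<Union>\<H>\<close> by blast
    then have "F \<inter> H \<subseteq> G" using joint assms(2) by auto
    then show "x \<in> G" using \<open>x \<in> F\<close> \<open>x \<in> H\<close> by blast
  qed
  then show False
    using facets_antichain[of F \<Delta> G] \<open>G \<in> facets \<Delta>\<close> \<open>G \<noteq> F\<close> assms(1) by (simp add: leaf_def)
qed

theorem theorem4p3:
  fixes \<Delta> :: "'v::finite set set"
    and F :: "nat \<Rightarrow> 'v set"
    and q t :: nat
    and I J K :: "('v, 'k::field) polyring set"
  assumes "simplicial_tree (UNIV :: 'v set) \<Delta>"
    and "good_leaf (F 0) \<Delta>"
    and "good_leaf_order \<Delta> F q"
    and "t < q"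
    and "\<forall>i. 1 \<le> i \<and> i < t \<longrightarrow> F 0 \<inter> F (Suc i) \<subseteq> F 0 \<inter> F i"
    and "F 0 \<inter> F (Suc t) \<subset> F 0 \<inter> F t"
    and "\<forall>j. t < j \<and> j \<le> q \<longrightarrow> F 0 \<inter> F j = {}"
    and "I = facet_ideal \<Delta>"
    and "J = ideal_gen (facet_monomial ` F ` {0..t})"
    and "K = ideal_gen (facet_monomial ` F ` {Suc t..q})"
  shows "splitting I J K"
proof -
  have bij: "bij_betw F {0..q} (facets \<Delta>)" and leaves: "\<And>i. i \<le> q \<Longrightarrow> leaf (F i) (complex_of (F ` {0..i}))"
    using assms(3) unfolding good_leaf_order_def by auto
  have facets: "F ` {0..q} = facets \<Delta>"
    by (rule bij_betw_imp_surj_on[OF bij])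
  have inj: "F i = F j \<longleftrightarrow> i = j" if "i \<le> q" "j \<le> q" for i j
    using bij_betw_imp_inj_on[OF bij] that by (auto simp: inj_on_def)
  have anti: "a = b" if "a \<in> F ` {0..q}" "b \<in> F ` {0..q}" "a \<subseteq> b" for a b
    using facets_antichain that unfolding facets .
  have split: "F ` {0..t} \<union> F ` {Suc t..q} = F ` {0..q}"
    unfolding image_Un[symmetric] using \<open>t < q\<close> by (intro arg_cong[where f = "image F"]) auto
  \<comment> \<open>The descending chain puts \<open>F 0 \<inter> F t\<close> inside each
    \<open>F 0 \<inter> F i\<close>, and it is nonempty because it strictly contains another set.
    The chain starts at index 1, so \<open>i = 0\<close> is separate: there \<open>F 0\<close>
    itself is nonempty.\<close>
  have meet: "F i \<inter> F 0 \<noteq> {}" if "i \<le> t" for i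
  proof (cases "i = 0")
    case False
    have "F 0 \<inter> F t \<subseteq> F 0 \<inter> F i"
      using \<open>i \<le> t\<close>
    proof (induction i rule: inc_induct)
      case (step n)
      \<comment> \<open>The induction descends from \<open>t\<close>, and \<open>n\<close> stays at
        least the original nonzero \<open>i\<close>, so the chain hypothesis applies.\<close>
      have "F 0 \<inter> F (Suc n) \<subseteq> F 0 \<inter> F n"
        using assms(5) False step.hyps by simp
      with step.IH show ?case by (rule subset_trans)
    qed simp
    moreover have "F 0 \<inter> F t \<noteq> {}" using assms(6) by auto
    ultimately show ?thesis by auto
  qed (use assms(6) in auto)
  \<comment> \<open>Since \<open>t < j\<close>, the facets \<open>F 0\<close> to \<open>F t\<close>
    all belong to the complex of which \<open>F j\<close> is a leaf; injectivity of the order makes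
    them different from \<open>F j\<close>.\<close>
  have uncovered: "\<not> F j \<subseteq> \<Union>(F ` {0..t})" if "t < j" "j \<le> q" for j
  proof (rule leaf_not_subset_Union[OF leaves[OF \<open>j \<le> q\<close>]])
    have "F ` {0..j} \<subseteq> F ` {0..q}" using \<open>j \<le> q\<close> by (intro image_mono) simp
    then have "facets (complex_of (F ` {0..j})) = F ` {0..j}"
      by (intro facets_complex_of) (meson anti subsetD)
    then show "F ` {0..t} \<subseteq> facets (complex_of (F ` {0..j})) - {F j}"
      using inj that by auto
  qed simp
  have "splitting (ideal_gen (facet_monomial ` (F ` {0..t} \<union> F ` {Suc t..q})))
    (ideal_gen (facet_monomial ` F ` {0..t}))
    (ideal_gen (facet_monomial ` F ` {Suc t..q}) :: ('v, 'k) polyring set)"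
  \<comment> \<open>The good leaf is the separating set: the facets up to index \<open>t\<close>
    meet it and the later ones miss it.\<close>
  proof (rule splitting_facet_monomials[where C = "F 0"])
    show "F ` {Suc t..q} \<noteq> {}" using \<open>t < q\<close> by simp
    show "b \<inter> F 0 = {}" if "b \<in> F ` {Suc t..q}" for b
    proof -
      from that obtain j where "b = F j" "t < j" "j \<le> q" by auto
      then show ?thesis using assms(7) Int_commute[of "F j" "F 0"] by simp
    qed
    show "\<not> b \<subseteq> \<Union>(F ` {0..t})" if "b \<in> F ` {Suc t..q}" for b
      using that uncovered by auto
    show "a \<inter> F 0 \<noteq> {}" if "a \<in> F ` {0..t}" for a
      using that meet by auto
    show "a = b" if "a \<in> F ` {0..t} \<union> F ` {Suc t..q}" "b \<in> F ` {0..t} \<union> F ` {Suc t..q}" "a \<subseteq> b" for a b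
      using that unfolding split by (rule anti)
  qed simp
  then show ?thesis
    by (simp add: split facets assms(8-10) facet_ideal_def)
qed

end
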